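(* Let $v=\{v(n)\}_{n\in\mathbb N}$ be a bounded real sequence which is almost polyadicly continuous. Then $v$ has a mean value $E(v)=\lim_{N\to\infty}\frac1N\sum_{n=1}^N v(n)$, and for every sequence $\{k_n\}$ of positive integers uniformly distributed in $\mathbb Z$ we have $$\lim_{N\to\infty}\frac1N\sum_{n=1}^N v(k_n)=E(v).$$
   Context: For $m\in\mathbb N$ and $r\in\{0,1,2,\dots\}$ let $r+(m)=\{n\in\mathbb N: n\equiv r \pmod m\}$. For $A\subset\mathbb N$, Buck's measure density is $\mu^\ast(A)=\inf\{\sum_{j=1}^k \frac1{m_j}: A\subset\bigcup_{j=1}^k (r_j+(m_j))\}$. A set $A$ is Buck measurable if $\mu^\ast(A)+\mu^\ast(\mathbb N\setminus A)=1$; on Buck measurable sets $\mu=\mu^\ast$ is a finitely additive probability measure. A sequence $v$ is polyadicly continuous on $A\subset\mathbb N$ if for every $\varepsilon>0$ there is $m\in\mathbb N$ such that for all $n_1,n_2\in A$, $n_1\equiv n_2\pmod m$ implies $|v(n_1)-v(n_2)|<\varepsilon$. A sequence $v$ is almost polyadicly continuous if for every $\delta>0$ there is a Buck measurable set $B\subset\mathbb N$ with $\mu(B)\le\delta$ such that $v$ is polyadicly continuous on $\mathbb N\setminus B$. A sequence $\{k_n\}$ of positive integers is uniformly distributed in $\mathbb Z$ if for every $m\in\mathbb N$ and $r\in\{0,1,\dots\}$ the set $\{n: k_n\in r+(m)\}$ has asymptotic density $\frac1m$ (asymptotic density of $A$: $\lim_{N\to\infty}\frac1N|\{n\le N: n\in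 A\}|$). *)

theory Defs
  imports "HOL-Analysis.Analysis" "HOL-Number_Theory.Cong"
begin

(* The set of natural numbers of the source is the set {1..} of positive integers.
   Sequences indexed by it are functions on nat whose value at 0 is never inspected. *)

definition residue_class :: "nat \<Rightarrow> nat \<Rightarrow> nat set" where
  "residue_class r m = {n \<in> {1..}. [n = r] (mod m)}"

(* For A a set of positive integers the infimum is over a nonempty set (A is covered by
   the class 0 + (1)) that is bounded below by 0. *)
definition buck_density :: "nat set \<Rightarrow> real" where
  "buck_density A = Inf {(\<Sum>j=1..k. 1 / real (m j)) | (k :: nat) (r :: nat \<Rightarrow> nat) (m :: nat \<Rightarrow> nat).
     (\<forall>j\<in>{1..k}. m j \<ge> 1) \<and> A \<subseteq> (\<Union>j\<in>{1..k}. residue_class (r j) (m j))}"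

definition buck_measurable :: "nat set \<Rightarrow> bool" where
  "buck_measurable A \<longleftrightarrow> A \<subseteq> {1..} \<and> buck_density A + buck_density ({1..} - A) = 1"

definition polyadicly_continuous_on :: "nat set \<Rightarrow> (nat \<Rightarrow> real) \<Rightarrow> bool" where
  "polyadicly_continuous_on A v \<longleftrightarrow>
     (\<forall>\<epsilon>>0. \<exists>m\<ge>1. \<forall>n1\<in>A. \<forall>n2\<in>A. [n1 = n2] (mod m) \<longrightarrow> \<bar>v n1 - v n2\<bar> < \<epsilon>)"

(* The measure mu is the restriction of buck_density to Buck measurable sets. *)
definition almost_polyadicly_continuous :: "(nat \<Rightarrow> real) \<Rightarrow> bool" where
  "almost_polyadicly_continuous v \<longleftrightarrow>
     (\<forall>\<delta>>0. \<exists>B. buck_measurable B \<and> buck_density B \<le> \<delta> \<and>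
        polyadicly_continuous_on ({1..} - B) v)"

definition has_asymptotic_density :: "nat set \<Rightarrow> real \<Rightarrow> bool" where
  "has_asymptotic_density A d \<longleftrightarrow>
     (\<lambda>N. real (card {n \<in> {1..N}. n \<in> A}) / real N) \<longlonglongrightarrow> d"

definition uniformly_distributed_in_Z :: "(nat \<Rightarrow> nat) \<Rightarrow> bool" where
  "uniformly_distributed_in_Z k \<longleftrightarrow>
     (\<forall>m\<ge>1. \<forall>r. has_asymptotic_density {n \<in> {1..}. k n \<in> residue_class r m} (1 / real m))"

definition average :: "(nat \<Rightarrow> real) \<Rightarrow> nat \<Rightarrow> real" where
  "average v N = (\<Sum>n=1..N. v n) / real N"

definition mean_value :: "(nat \<Rightarrow> real) \<Rightarrow> real" where
  "mean_value v = lim (average v)"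

end

theory Submission
  imports Defs
begin

text \<open>
  Up to a uniform error \<open>\<epsilon>\<close> off a set \<open>B\<close> of small Buck density, \<open>v\<close> agrees with a periodic
  function. Along a uniformly distributed sequence a periodic function has mean equal to its mean
  over one period, and the finitely many residue classes covering \<open>B\<close> are visited with frequency
  equal to the sum of the reciprocals of their moduli. Hence the averages of \<open>v\<close> along any two such
  sequences, one of which is the identity, are eventually within \<open>\<epsilon>\<close> of one common constant.
\<close>

lemma average_sum: "average (\<lambda>n. \<Sum>i\<in>I. f i n) N = (\<Sum>i\<in>I. average (f i) N)"
  unfolding average_def sum_divide_distrib by (rule sum.swap)

lemma average_add: "average (\<lambda>n. f n + g n) N = average f N + average g N"
  by (simp add: average_def sum.distrib add_divide_distrib)

lemma average_cmult: "average (\<lambda>n. c * f n) N = c * average f N"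
  by (simp add: average_def sum_distrib_left)

lemma average_const: "N \<ge> 1 \<Longrightarrow> average (\<lambda>n. c) N = c"
  by (simp add: average_def)

lemma average_mono:
  assumes "\<And>n. n \<ge> 1 \<Longrightarrow> f n \<le> g n"
  shows "average f N \<le> average g N"
  unfolding average_def by (intro divide_right_mono sum_mono) (auto intro: assms)

lemma abs_average_diff_le:
  assumes "\<And>n. n \<ge> 1 \<Longrightarrow> \<bar>f n - g n\<bar> \<le> h n"
  shows "\<bar>average f N - average g N\<bar> \<le> average h N"
proof -
  have "\<bar>average f N - average g N\<bar> = \<bar>\<Sum>n=1..N. f n - g n\<bar> / real N"
    by (simp add: average_def sum_subtractf flip: diff_divide_distrib)
  also have "\<dots> \<le> (\<Sum>n=1..N. h n) / real N"
    by (intro divide_right_mono order.trans[OF sum_abs] sum_mono) (auto intro: assms)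
  finally show ?thesis by (simp add: average_def)
qed

lemma has_asymptotic_density_iff_average:
  "has_asymptotic_density A d \<longleftrightarrow> average (\<lambda>n. of_bool (n \<in> A)) \<longlonglongrightarrow> d"
proof -
  have "real (card {n \<in> {1..N}. n \<in> A}) / real N = average (\<lambda>n. of_bool (n \<in> A)) N" for N
    by (simp add: average_def Int_def)
  then show ?thesis
    unfolding has_asymptotic_density_def by presburger
qed

lemma average_residue_class:
  assumes k: "\<forall>n\<ge>1. k n \<ge> 1" and ud: "uniformly_distributed_in_Z k" and "m \<ge> 1"
  shows "average (\<lambda>n. of_bool ([k n = r] (mod m))) \<longlonglongrightarrow> 1 / real m"
proof -
  \<comment> \<open>Residue classes contain positive integers only, so positivity of
    \<open>k n\<close> reduces membership to a congruence.\<close>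
  have "average (\<lambda>n. of_bool (n \<in> {n \<in> {1..}. k n \<in> residue_class r m})) N
      = average (\<lambda>n. of_bool ([k n = r] (mod m))) N" for N
    unfolding average_def
    by (intro arg_cong2[where f = "(/)"] sum.cong) (use k in \<open>auto simp: residue_class_def\<close>)
  moreover have "average (\<lambda>n. of_bool (n \<in> {n \<in> {1..}. k n \<in> residue_class r m}))
      \<longlonglongrightarrow> 1 / real m"
    using ud \<open>m \<ge> 1\<close>
    unfolding uniformly_distributed_in_Z_def has_asymptotic_density_iff_average by blast
  ultimately show ?thesis by presburger
qed

text \<open>A function of \<open>k n mod m\<close> is a finite linear combination of indicators of
  residue classes, each with mean \<open>1 / real m\<close>. The limit depends on \<open>g\<close>
  and \<open>m\<close> but not on \<open>k\<close>.\<close>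

lemma average_periodic:
  assumes "\<forall>n\<ge>1. k n \<ge> 1" and "uniformly_distributed_in_Z k" and "m \<ge> 1"
  shows "average (\<lambda>n. g (k n mod m)) \<longlonglongrightarrow> (\<Sum>r<m. g r) / real m"
proof -
  have decomp: "g (k n mod m) = (\<Sum>r<m. g r * of_bool ([k n = r] (mod m)))" for n
  proof -
    have "(\<Sum>r<m. g r * of_bool ([k n = r] (mod m))) = (\<Sum>r<m. if k n mod m = r then g r else 0)"
      by (intro sum.cong) (auto simp: cong_def)
    then show ?thesis using \<open>m \<ge> 1\<close> by simp
  qed
  have "average (\<lambda>n. g (k n mod m))
      = (\<lambda>N. \<Sum>r<m. g r * average (\<lambda>n. of_bool ([k n = r] (mod m))) N)"
    by (rule ext) (simp only: decomp average_sum average_cmult)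
  moreover have "(\<lambda>N. \<Sum>r<m. g r * average (\<lambda>n. of_bool ([k n = r] (mod m))) N)
      \<longlonglongrightarrow> (\<Sum>r<m. g r * (1 / real m))"
    by (intro tendsto_intros average_residue_class assms)
  ultimately show ?thesis by (simp add: sum_divide_distrib)
qed

text \<open>The integers in question are r, r + m, r + 2m, ..., and
  \<open>(N + (m - r)) div m\<close> counts them up to N starting from 0. The shift by
  \<open>m - r\<close> avoids the truncated difference \<open>N - r\<close> when N < r. The interval
  starts at 1, so \<open>of_bool (r = 0)\<close> restores the point 0.\<close>

lemma card_residue_class_interval:
  fixes r m N :: nat
  assumes "r < m"
  shows "card {n \<in> {1..N}. n mod m = r} + of_bool (r = 0) = (N + (m - r)) div m"
proof (induction N)
  case 0
  then show ?case using assms by (auto simp: div_eq_0_iff)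
next
  case (Suc N)
  \<comment> \<open>Adding \<open>m - r\<close> turns the condition on the remainder into
    divisibility by m, which is exactly when the quotient in \<open>div_Suc\<close> grows by
    one.\<close>
  have "Suc N mod m = r \<longleftrightarrow> [Suc N + (m - r) = r + (m - r)] (mod m)"
    unfolding cong_add_rcancel_nat using assms by (simp add: cong_def)
  also have "\<dots> \<longleftrightarrow> Suc (N + (m - r)) mod m = 0"
    using assms by (simp add: cong_def)
  finally have "Suc N mod m = r \<longleftrightarrow> Suc (N + (m - r)) mod m = 0" .
  moreover have "{n \<in> {1..Suc N}. n mod m = r}
      = (if Suc N mod m = r then insert (Suc N) {n \<in> {1..N}. n mod m = r}
         else {n \<in> {1..N}. n mod m = r})"
    by (auto simp: le_Suc_eq)
  ultimately show ?case
    using Suc.IH by (simp add: div_Suc)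
qed

text \<open>This makes the averages of \<open>v\<close> itself the special case of averages along
  the identity. The count of a class up to N differs from N / m by at most a constant, so its
  frequency has error O(1 / N).\<close>

lemma uniformly_distributed_in_Z_id: "uniformly_distributed_in_Z (\<lambda>n. n)"
  unfolding uniformly_distributed_in_Z_def
proof (intro allI impI)
  fix m r :: nat assume "m \<ge> 1"
  define c where "c N = card {n \<in> {1..N}. n mod m = r mod m}" for N
  have bound: "\<bar>real (c N) / real N - 1 / real m\<bar> \<le> 2 / real N" if "N \<ge> 1" for N
  proof -
    \<comment> \<open>The exact count needs a remainder below m, whereas r is arbitrary.\<close>
    define s where "s = r mod m"
    have "s < m" using \<open>m \<ge> 1\<close> by (simp add: s_def)
    define q where "q = (N + (m - s)) div m"
    have cq: "c N + of_bool (s = 0) = q"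
      unfolding c_def q_def using card_residue_class_interval[OF \<open>s < m\<close>] by (simp add: s_def)
    have "\<lfloor>real (N + (m - s)) / real m\<rfloor> = int q"
      unfolding q_def by (rule floor_divide_of_nat_eq)
    then have "real q \<le> real (N + (m - s)) / real m" "real (N + (m - s)) / real m < real q + 1"
      by (simp_all only: floor_eq_iff of_int_of_nat_eq)
    moreover have "real (N + (m - s)) / real m = real N / real m + 1 - real s / real m"
      using \<open>s < m\<close> by (simp add: of_nat_diff field_simps)
    moreover have "0 \<le> real s / real m" "real s / real m \<le> 1"
      using \<open>s < m\<close> by simp_all
    moreover have "real (c N) + of_bool (s = 0) = real q"
      using cq by (metis of_nat_add of_nat_of_bool)
    moreover have "0 \<le> (of_bool (s = 0) :: real)" "of_bool (s = 0) \<le> (1 :: real)"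
      by simp_all
    ultimately have "\<bar>real (c N) - real N / real m\<bar> \<le> 2"
      by linarith
    then have "\<bar>real (c N) - real N / real m\<bar> / real N \<le> 2 / real N"
      by (intro divide_right_mono) auto
    moreover have "\<bar>real (c N) / real N - 1 / real m\<bar> = \<bar>real (c N) - real N / real m\<bar> / real N"
    proof -
      have "real (c N) / real N - 1 / real m = (real (c N) - real N / real m) / real N"
        using that by (simp add: diff_divide_distrib)
      then show ?thesis by (simp add: abs_divide)
    qed
    ultimately show ?thesis by simp
  qed
  have "(\<lambda>N. real (c N) / real N - 1 / real m) \<longlonglongrightarrow> 0"
  proof (rule Lim_null_comparison)
    show "\<forall>\<^sub>F N in sequentially. norm (real (c N) / real N - 1 / real m) \<le> 2 / real N"
      using eventually_ge_at_top[of 1] by eventually_elim (use bound in simp)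
    show "(\<lambda>N. 2 / real N) \<longlonglongrightarrow> 0"
      by (rule lim_const_over_n)
  qed
  then have "(\<lambda>N. real (c N) / real N) \<longlonglongrightarrow> 1 / real m"
    by (simp add: LIM_zero_iff)
  moreover have "{n \<in> {1..N}. n \<in> {n \<in> {1..}. n \<in> residue_class r m}}
      = {n \<in> {1..N}. n mod m = r mod m}" for N
    by (auto simp: residue_class_def cong_def)
  ultimately show "has_asymptotic_density {n \<in> {1..}. n \<in> residue_class r m} (1 / real m)"
    unfolding has_asymptotic_density_def c_def by simp
qed

lemma buck_density_less_obtain_cover:
  assumes "buck_density A < x" and "A \<subseteq> {1..}"
  obtains l :: nat and r m :: "nat \<Rightarrow> nat"
  where "\<forall>j\<in>{1..l}. m j \<ge> 1" "A \<subseteq> (\<Union>j\<in>{1..l}. residue_class (r j) (m j))"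
    "(\<Sum>j=1..l. 1 / real (m j)) < x"
proof -
  let ?S = "{(\<Sum>j=1..k. 1 / real (m j)) | (k :: nat) (r :: nat \<Rightarrow> nat) (m :: nat \<Rightarrow> nat).
     (\<forall>j\<in>{1..k}. m j \<ge> 1) \<and> A \<subseteq> (\<Union>j\<in>{1..k}. residue_class (r j) (m j))}"
  \<comment> \<open>The single class 0 + (1) covers A, so the infimum is over a nonempty set and
    some cover has sum below x.\<close>
  have "(\<Sum>j=1..1. 1 / real ((\<lambda>_::nat. 1) j)) \<in> ?S"
    by (rule CollectI, rule exI[of _ 1], rule exI[of _ "\<lambda>_. 0"], rule exI[of _ "\<lambda>_. 1"])
      (use assms(2) in \<open>auto simp: residue_class_def cong_def\<close>)
  then have "?S \<noteq> {}" by blast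
  from cInf_lessD[OF this] assms(1) show ?thesis
    unfolding buck_density_def using that by blast
qed

text \<open>The indicator of B is at most the sum of the indicators of finitely many covering
  classes. Along k these have means adding up to the sum of the reciprocal moduli, which is below
  x.\<close>

lemma eventually_average_less_of_buck_density_less:
  assumes k: "\<forall>n\<ge>1. k n \<ge> 1" "uniformly_distributed_in_Z k"
    and "buck_density B < x" and "B \<subseteq> {1..}"
  shows "\<forall>\<^sub>F N in sequentially. average (\<lambda>n. of_bool (k n \<in> B)) N < x"
proof -
  obtain l :: nat and r m :: "nat \<Rightarrow> nat" where m: "\<forall>j\<in>{1..l}. m j \<ge> 1"
    and cover: "B \<subseteq> (\<Union>j\<in>{1..l}. residue_class (r j) (m j))"
    and less: "(\<Sum>j=1..l. 1 / real (m j)) < x"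
    by (rule buck_density_less_obtain_cover[OF assms(3,4)]) blast
  let ?f = "\<lambda>j n. of_bool ([k n = r j] (mod m j)) :: real"
  have le: "of_bool (k n \<in> B) \<le> (\<Sum>j=1..l. ?f j n)" for n
  proof (cases "k n \<in> B")
    case True
    then obtain j where j: "j \<in> {1..l}" "[k n = r j] (mod m j)"
      using cover by (auto simp: residue_class_def)
    then have "?f j n \<le> (\<Sum>j=1..l. ?f j n)"
      by (intro member_le_sum) auto
    then show ?thesis using j True by simp
  qed (simp add: sum_nonneg)
  have "(\<lambda>N. \<Sum>j=1..l. average (?f j) N) \<longlonglongrightarrow> (\<Sum>j=1..l. 1 / real (m j))"
    by (intro tendsto_sum average_residue_class k m[rule_format])
  then have "\<forall>\<^sub>F N in sequentially. (\<Sum>j=1..l. average (?f j) N) < x"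
    using less by (rule order_tendstoD)
  then show ?thesis
  proof eventually_elim
    case (elim N)
    have "average (\<lambda>n. of_bool (k n \<in> B)) N \<le> average (\<lambda>n. \<Sum>j=1..l. ?f j n) N"
      by (intro average_mono le)
    then show ?case using elim unfolding average_sum by linarith
  qed
qed

text \<open>On each residue class meeting A, take the value of \<open>v\<close> at one chosen
  representative in A; polyadic continuity makes \<open>v\<close> vary by less than \<epsilon> on
  that part of A.\<close>

lemma polyadicly_continuous_on_periodic_approx:
  assumes "polyadicly_continuous_on A v" and "\<epsilon> > 0" and bd: "\<And>n. n \<in> A \<Longrightarrow> \<bar>v n\<bar> \<le> C" and "C \<ge> 0"
  obtains m g where "m \<ge> 1" "\<And>n. n \<in> A \<Longrightarrow> \<bar>v n - g (n mod m)\<bar> < \<epsilon>" "\<And>n. \<bar>g n\<bar> \<le> C"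
proof -
  obtain m where "m \<ge> 1"
    and m: "\<And>a b. a \<in> A \<Longrightarrow> b \<in> A \<Longrightarrow> [a = b] (mod m) \<Longrightarrow> \<bar>v a - v b\<bar> < \<epsilon>"
    using assms(1,2) unfolding polyadicly_continuous_on_def by blast
  define rep where "rep s = (SOME a. a \<in> A \<and> a mod m = s)" for s
  \<comment> \<open>The default 0 on classes missing A keeps the bound C valid for every
    argument.\<close>
  define g where "g s = (if \<exists>a\<in>A. a mod m = s then v (rep s) else 0)" for s
  have rep: "rep s \<in> A \<and> rep s mod m = s" if "\<exists>a\<in>A. a mod m = s" for s
    unfolding rep_def by (rule someI_ex) (use that in blast)
  show ?thesis
  proof
    show "m \<ge> 1" by fact
    show "\<bar>v n - g (n mod m)\<bar> < \<epsilon>" if "n \<in> A" for n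
    proof -
      have ex: "\<exists>a\<in>A. a mod m = n mod m" using that by blast
      show ?thesis using m[OF that, of "rep (n mod m)"] rep[OF ex] ex by (simp add: g_def cong_def)
    qed
    show "\<bar>g n\<bar> \<le> C" for n
      using rep bd \<open>C \<ge> 0\<close> by (simp add: g_def)
  qed
qed

text \<open>The constant is fixed before k: it is the mean of the approximating periodic function
  over one period. Hence it can be used for a given sequence and the identity at once.\<close>

lemma eventually_average_near_common_constant:
  assumes "bounded (v ` {1..})" and "almost_polyadicly_continuous v" and "\<epsilon> > 0"
  obtains c where "\<And>k. \<forall>n\<ge>1. k n \<ge> 1 \<Longrightarrow> uniformly_distributed_in_Z k \<Longrightarrow>
    \<forall>\<^sub>F N in sequentially. \<bar>average (\<lambda>n. v (k n)) N - c\<bar> < \<epsilon>"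
proof -
  obtain C where "C > 0" and C: "\<And>n. n \<ge> 1 \<Longrightarrow> \<bar>v n\<bar> \<le> C"
    using assms(1) unfolding bounded_pos by auto
  \<comment> \<open>The error on B is at most 2C, with visit frequency below
    \<open>2 * \<delta>\<close>, so it contributes less than 4C\<delta> = \<epsilon> / 3. Another
    \<epsilon> / 3 comes from the approximation off B, and the last from the periodic mean.\<close>
  define \<delta> where "\<delta> = \<epsilon> / (12 * C)"
  have "\<delta> > 0" using \<open>C > 0\<close> \<open>\<epsilon> > 0\<close> by (simp add: \<delta>_def)
  then obtain B where "buck_measurable B" and "buck_density B \<le> \<delta>"
    and pc: "polyadicly_continuous_on ({1..} - B) v"
    using assms(2) unfolding almost_polyadicly_continuous_def by blast
  \<comment> \<open>Doubling \<delta> gives the strict inequality needed to extract a finite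
    cover.\<close>
  then have B: "B \<subseteq> {1..}" "buck_density B < 2 * \<delta>"
    using \<open>\<delta> > 0\<close> by (auto simp: buck_measurable_def)
  obtain m g where "m \<ge> 1" and near: "\<And>n. n \<in> {1..} - B \<Longrightarrow> \<bar>v n - g (n mod m)\<bar> < \<epsilon> / 3"
    and g: "\<And>n. \<bar>g n\<bar> \<le> C"
    by (rule polyadicly_continuous_on_periodic_approx[OF pc, of "\<epsilon> / 3" C])
      (use C \<open>C > 0\<close> \<open>\<epsilon> > 0\<close> in auto)
  show ?thesis
  proof
    fix k assume k: "\<forall>n\<ge>1. k n \<ge> 1" "uniformly_distributed_in_Z k"
    \<comment> \<open>Off B the periodic approximation applies; on B only the bound C on both
      functions is available.\<close>
    have diff: "\<bar>v (k n) - g (k n mod m)\<bar> \<le> \<epsilon> / 3 + 2 * C * of_bool (k n \<in> B)" if "n \<ge> 1" for n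
    proof (cases "k n \<in> B")
      case True
      have "\<bar>v (k n) - g (k n mod m)\<bar> \<le> 2 * C"
        using C[of "k n"] g[of "k n mod m"] k(1) that by (simp add: abs_le_iff)
      then show ?thesis using True \<open>\<epsilon> > 0\<close> by simp
    next
      case False
      then show ?thesis using near[of "k n"] k(1) that by simp
    qed
    have "\<forall>\<^sub>F N in sequentially. \<bar>average (\<lambda>n. g (k n mod m)) N - (\<Sum>r<m. g r) / real m\<bar> < \<epsilon> / 3"
      using tendstoD[OF average_periodic[OF k \<open>m \<ge> 1\<close>], of "\<epsilon> / 3" g] \<open>\<epsilon> > 0\<close>
      by (simp add: dist_real_def)
    then show "\<forall>\<^sub>F N in sequentially. \<bar>average (\<lambda>n. v (k n)) N - (\<Sum>r<m. g r) / real m\<bar> < \<epsilon>"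
      using eventually_average_less_of_buck_density_less[OF k B(2,1)] eventually_ge_at_top[of 1]
    proof eventually_elim
      case (elim N)
      have "\<bar>average (\<lambda>n. v (k n)) N - average (\<lambda>n. g (k n mod m)) N\<bar>
          \<le> \<epsilon> / 3 + 2 * C * average (\<lambda>n. of_bool (k n \<in> B)) N"
        using abs_average_diff_le[OF diff, where N = N] elim(3)
        by (simp add: average_add average_cmult average_const)
      also have "\<dots> < \<epsilon> / 3 + 2 * C * (2 * \<delta>)"
        using elim(2) \<open>C > 0\<close> by (intro add_strict_left_mono mult_strict_left_mono) auto
      also have "\<dots> = 2 * \<epsilon> / 3"
        using \<open>C > 0\<close> by (simp add: \<delta>_def field_simps)
      finally show ?case using elim(1) by linarith
    qed
  qed
qed

theorem theorem3:
  fixes v :: "nat \<Rightarrow> real"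
  assumes "bounded (v ` {1..})"
    and "almost_polyadicly_continuous v"
  shows "convergent (average v) \<and>
    (\<forall>k :: nat \<Rightarrow> nat. (\<forall>n\<ge>1. k n \<ge> 1) \<longrightarrow> uniformly_distributed_in_Z k \<longrightarrow>
       average (\<lambda>n. v (k n)) \<longlonglongrightarrow> mean_value v)"
proof -
  \<comment> \<open>The constant c varies with \<epsilon>, so no limit is at hand; closeness of the
    tail to c, with the identity as k, gives the Cauchy property.\<close>
  have conv: "convergent (average v)"
    unfolding Cauchy_convergent_iff[symmetric]
  proof (rule metric_CauchyI)
    fix \<epsilon> :: real assume "\<epsilon> > 0"
    then obtain c where c: "\<And>k. \<forall>n\<ge>1. k n \<ge> 1 \<Longrightarrow> uniformly_distributed_in_Z k \<Longrightarrow>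
        \<forall>\<^sub>F N in sequentially. \<bar>average (\<lambda>n. v (k n)) N - c\<bar> < \<epsilon> / 2"
      using eventually_average_near_common_constant[OF assms, of "\<epsilon> / 2"] by (metis half_gt_zero)
    from c[of "\<lambda>n. n"] obtain M where "\<forall>N\<ge>M. \<bar>average v N - c\<bar> < \<epsilon> / 2"
      by (auto simp: uniformly_distributed_in_Z_id eventually_sequentially)
    then show "\<exists>M. \<forall>i\<ge>M. \<forall>j\<ge>M. dist (average v i) (average v j) < \<epsilon>"
      unfolding dist_real_def by (intro exI[of _ M]) (smt (verit) field_sum_of_halves)
  qed
  moreover have "average (\<lambda>n. v (k n)) \<longlonglongrightarrow> mean_value v"
    if k: "\<forall>n\<ge>1. k n \<ge> 1" "uniformly_distributed_in_Z k" for k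
  proof -
    \<comment> \<open>For each \<epsilon> both averages are eventually within \<epsilon> / 2 of the
      same c, so the average along k inherits the limit of \<open>average v\<close>.\<close>
    have "(\<lambda>N. average (\<lambda>n. v (k n)) N - average v N) \<longlonglongrightarrow> 0"
    proof (rule tendstoI)
      fix \<epsilon> :: real assume "\<epsilon> > 0"
      then obtain c where c: "\<And>k. \<forall>n\<ge>1. k n \<ge> 1 \<Longrightarrow> uniformly_distributed_in_Z k \<Longrightarrow>
          \<forall>\<^sub>F N in sequentially. \<bar>average (\<lambda>n. v (k n)) N - c\<bar> < \<epsilon> / 2"
        using eventually_average_near_common_constant[OF assms, of "\<epsilon> / 2"] by (metis half_gt_zero)
      have "\<forall>\<^sub>F N in sequentially. \<bar>average v N - c\<bar> < \<epsilon> / 2"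
        using c[of "\<lambda>n. n"] by (simp add: uniformly_distributed_in_Z_id)
      with c[OF k]
      show "\<forall>\<^sub>F N in sequentially. dist (average (\<lambda>n. v (k n)) N - average v N) 0 < \<epsilon>"
        by eventually_elim (unfold dist_real_def, linarith)
    qed
    moreover have "average v \<longlonglongrightarrow> mean_value v"
      using conv by (simp add: mean_value_def convergent_LIMSEQ_iff)
    ultimately show ?thesis
      by (rule Lim_transform[rotated])
  qed
  ultimately show ?thesis by blast
qed

end
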